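(* Let $\{\phi_i\}_{i\in I}$ and $\{\psi_i\}_{i\in I}$ be two woven frames for $\mathcal H$. Then for any $\lambda\in\mathbb R$, $\sigma\subset I$ and $f\in\mathcal H$, $$\begin{aligned} 0\ \le\ &\sum_{i\in\sigma}|\langle f,\phi_i\rangle|^2-\sum_{i\in\sigma}|\langle S_{\mathcal W}^{\sigma}f,S_{\mathcal W}^{-1}\phi_i\rangle|^2-\sum_{i\in\sigma^c}|\langle S_{\mathcal W}^{\sigma}f,S_{\mathcal W}^{-1}\psi_i\rangle|^2\\ \le\ &\frac{\lambda^2}{4}\sum_{i\in\sigma^c}|\langle f,\psi_i\rangle|^2+\Big(1-\frac{\lambda}{2}\Big)^2\sum_{i\in\sigma}|\langle f,\phi_i\rangle|^2 . \end{aligned}$$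
   Context: $\mathcal H$ is a separable Hilbert space, $I$ is a countable index set, and for $\sigma\subset I$ one writes $\sigma^c=I\setminus\sigma$. A family $\{\phi_i\}_{i\in I}$ in $\mathcal H$ is a frame with lower and upper frame bounds $A,B>0$ if $A\|f\|^2\le\sum_{i\in I}|\langle f,\phi_i\rangle|^2\le B\|f\|^2$ for all $f\in\mathcal H$. Two frames $\{\phi_i\}_{i\in I}$ and $\{\psi_i\}_{i\in I}$ for $\mathcal H$ are woven if there are universal constants $A,B>0$ such that for every $\sigma\subset I$ the family $\{\phi_i\}_{i\in\sigma}\cup\{\psi_i\}_{i\in\sigma^c}$ (called a weaving) is a frame for $\mathcal H$ with lower and upper bounds $A$ and $B$. For given $\sigma\subset I$, define bounded linear operators on $\mathcal H$ by $S_{\mathcal W}^{\sigma}f=\sum_{i\in\sigma}\langle f,\phi_i\rangle\phi_i$, $S_{\mathcal W}^{\sigma^c}f=\sum_{i\in\sigma^c}\langle f,\psi_i\rangle\psi_i$, and $S_{\mathcal W}=S_{\mathcal W}^{\sigma}+S_{\mathcal W}^{\sigma^c}$; $S_{\mathcal W}$ is the frame operator of the weaving (it depends on $\sigma$), and it is bounded, invertible, self-adjoint and positive. *)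

theory Defs
  imports "HOL-Analysis.Analysis"
begin

(* The scalar fields of Hilbert spaces. The axioms leave only the reals and the complex
   numbers with their usual norm and conjugation: x * x* and (x + 1) * (x + 1)* are real,
   hence so is x + x*, and x is a root of a real quadratic polynomial. *)

class hilbert_scalar = real_normed_field +
  fixes conjg :: "'a \<Rightarrow> 'a"
  assumes conjg_add: "conjg (x + y) = conjg x + conjg y"
    and conjg_mult: "conjg (x * y) = conjg x * conjg y"
    and mult_conjg: "x * conjg x = (norm x)\<^sup>2 *\<^sub>R 1"

instantiation real :: hilbert_scalar
begin
definition conjg_real :: "real \<Rightarrow> real" where "conjg_real x = x"
instance by standard (simp_all add: conjg_real_def power2_eq_square)
end

instantiation complex :: hilbert_scalar
begin
definition conjg_complex :: "complex \<Rightarrow> complex" where "conjg_complex = cnj"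
instance
proof
  show "x * conjg x = (norm x)\<^sup>2 *\<^sub>R 1" for x :: complex
    unfolding conjg_complex_def of_real_def [symmetric] by (rule complex_norm_square [symmetric])
qed (simp_all add: conjg_complex_def)
end

(* The inner product is linear in its first argument. The class banach provides the norm
   topology and its completeness; ip_self makes the norm the one induced by the inner
   product (and ip positive definite), smul_of_real identifies the two real scalings. *)

locale separable_hilbert_space = vector_space smul
  for smul :: "'k::hilbert_scalar \<Rightarrow> 'v::banach \<Rightarrow> 'v" +
  fixes ip :: "'v \<Rightarrow> 'v \<Rightarrow> 'k"
  assumes smul_of_real: "smul (of_real r) x = r *\<^sub>R x"
    and ip_add_left: "ip (x + y) z = ip x z + ip y z"
    and ip_smul_left: "ip (smul a x) y = a * ip x y"
    and ip_commute: "ip y x = conjg (ip x y)"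
    and ip_self: "ip x x = of_real ((norm x)\<^sup>2)"
    and separable: "separable_space (euclidean :: 'v topology)"

lemma separable_space_euclidean:
  "separable_space (euclidean :: 'v::{metric_space, second_countable_topology} topology)"
proof -
  obtain D :: "'v set" where D: "countable D" "D \<subseteq> UNIV" "UNIV \<subseteq> closure D"
    by (rule separable)
  have "closure D = UNIV"
    using D(3) by (rule top_le)
  with D(1) have "countable D \<and> D \<subseteq> topspace euclidean \<and> euclidean closure_of D = topspace euclidean"
    by simp
  then show ?thesis
    unfolding separable_space_def by (rule exI)
qed

lemma separable_hilbert_space_real:
  "separable_hilbert_space (*\<^sub>R)
     (inner :: 'v::{real_inner, banach, second_countable_topology} \<Rightarrow> 'v \<Rightarrow> real)"
  by unfold_locales
    (simp_all add: conjg_real_def inner_add_left dot_square_norm separable_space_euclidean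
      scaleR_add_right scaleR_add_left, rule inner_commute)

lemma separable_hilbert_space_complex:
  "separable_hilbert_space (*) (\<lambda>x y :: complex. x * cnj y)"
proof unfold_locales
  show "x * cnj x = of_real ((norm x)\<^sup>2)" for x :: complex
    by (rule complex_norm_square [symmetric])
qed (simp_all add: conjg_complex_def scaleR_conv_of_real distrib_left distrib_right
      separable_space_euclidean)

(* Without summability, infsum would be 0. *)

definition frame_with_bounds ::
  "('v::real_normed_vector \<Rightarrow> 'v \<Rightarrow> 'k::hilbert_scalar) \<Rightarrow> 'i set \<Rightarrow> real \<Rightarrow> real \<Rightarrow> ('i \<Rightarrow> 'v) \<Rightarrow> bool"
  where "frame_with_bounds ip I A B \<phi> \<longleftrightarrow> A > 0 \<and> B > 0 \<and>
    (\<forall>f. (\<lambda>i. (norm (ip f (\<phi> i)))\<^sup>2) summable_on I \<and>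
         A * (norm f)\<^sup>2 \<le> (\<Sum>\<^sub>\<infinity>i\<in>I. (norm (ip f (\<phi> i)))\<^sup>2) \<and>
         (\<Sum>\<^sub>\<infinity>i\<in>I. (norm (ip f (\<phi> i)))\<^sup>2) \<le> B * (norm f)\<^sup>2)"

definition is_frame ::
  "('v::real_normed_vector \<Rightarrow> 'v \<Rightarrow> 'k::hilbert_scalar) \<Rightarrow> 'i set \<Rightarrow> ('i \<Rightarrow> 'v) \<Rightarrow> bool"
  where "is_frame ip I \<phi> \<longleftrightarrow> (\<exists>A B. frame_with_bounds ip I A B \<phi>)"

(* The union of the two subfamilies is a union of indexed families (repeated vectors count
   with multiplicity), hence again a family indexed by I. *)

definition weaving :: "'i set \<Rightarrow> ('i \<Rightarrow> 'v) \<Rightarrow> ('i \<Rightarrow> 'v) \<Rightarrow> 'i \<Rightarrow> 'v"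
  where "weaving \<sigma> \<phi> \<psi> i = (if i \<in> \<sigma> then \<phi> i else \<psi> i)"

definition woven_frames ::
  "('v::real_normed_vector \<Rightarrow> 'v \<Rightarrow> 'k::hilbert_scalar) \<Rightarrow> 'i set \<Rightarrow> ('i \<Rightarrow> 'v) \<Rightarrow> ('i \<Rightarrow> 'v) \<Rightarrow> bool"
  where "woven_frames ip I \<phi> \<psi> \<longleftrightarrow> is_frame ip I \<phi> \<and> is_frame ip I \<psi> \<and>
    (\<exists>A>0. \<exists>B>0. \<forall>\<sigma>\<subseteq>I. frame_with_bounds ip I A B (weaving \<sigma> \<phi> \<psi>))"

definition partial_frame_operator ::
  "('k::hilbert_scalar \<Rightarrow> 'v::real_normed_vector \<Rightarrow> 'v) \<Rightarrow> ('v \<Rightarrow> 'v \<Rightarrow> 'k) \<Rightarrow> 'i set \<Rightarrow> ('i \<Rightarrow> 'v) \<Rightarrow> 'v \<Rightarrow> 'v"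
  where "partial_frame_operator smul ip J \<phi> f = (\<Sum>\<^sub>\<infinity>i\<in>J. smul (ip f (\<phi> i)) (\<phi> i))"

definition weaving_frame_operator ::
  "('k::hilbert_scalar \<Rightarrow> 'v::real_normed_vector \<Rightarrow> 'v) \<Rightarrow> ('v \<Rightarrow> 'v \<Rightarrow> 'k) \<Rightarrow> 'i set \<Rightarrow>
    ('i \<Rightarrow> 'v) \<Rightarrow> ('i \<Rightarrow> 'v) \<Rightarrow> 'i set \<Rightarrow> 'v \<Rightarrow> 'v"
  where "weaving_frame_operator smul ip I \<phi> \<psi> \<sigma> f =
    partial_frame_operator smul ip \<sigma> \<phi> f + partial_frame_operator smul ip (I - \<sigma>) \<psi> f"

end

theory Submission
  imports Defs
begin

text \<open>
  Let \<open>q\<^sub>1\<close>, \<open>q\<^sub>2\<close> and \<open>q = q\<^sub>1 + q\<^sub>2\<close> be the quadratic forms of the operators \<open>S\<^sup>\<sigma>\<close>, \<open>S\<^sup>\<sigma>\<^sup>c\<close>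
  and \<open>S\<close>, and put \<open>g = S\<^sup>-\<^sup>1 S\<^sup>\<sigma> f\<close>. Self-adjointness of \<open>S\<close> turns the two sums containing \<open>S\<^sup>-\<^sup>1\<close> into
  \<open>q(g)\<close>, so the middle term is \<open>q\<^sub>1(f) - q(g)\<close>. As \<open>\<langle>S\<^sup>\<sigma> f, g\<rangle> = q(g)\<close> and \<open>\<langle>S g, f\<rangle> = q\<^sub>1(f)\<close>, the lower
  bound follows from \<open>q\<^sub>1(f - g) \<ge> 0\<close> and \<open>q\<^sub>1 \<le> q\<close>, the upper bound from \<open>q(g - (\<lambda>/2) f) \<ge> 0\<close>.
  Surjectivity of \<open>S\<close>, which makes \<open>S\<^sup>-\<^sup>1\<close> a right inverse, comes from Banach's fixed point theorem:
  the map \<open>x \<mapsto> x - (S x - y)/B\<close> is a contraction.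
\<close>

section \<open>Scalars and inner products\<close>

lemma conjg_zero [simp]: "conjg (0::'k::hilbert_scalar) = 0"
  using conjg_add[of "0::'k" 0] by simp

text \<open>Compatibility with real scalars is not an axiom; \<open>mult_conjg\<close> gives r *
  conjg r = r * r, and r cancels.\<close>

lemma conjg_of_real [simp]: "conjg (of_real r :: 'k::hilbert_scalar) = of_real r"
proof (cases "r = 0")
  case False
  have "(of_real r :: 'k) * conjg (of_real r) = of_real r * of_real r"
    by (simp add: mult_conjg of_real_def power2_eq_square)
  then show ?thesis
    using False by simp
qed simp

lemma norm_conjg [simp]: "norm (conjg x) = norm (x::'k::hilbert_scalar)"
proof (cases "x = 0")
  case False
  have "norm x * norm (conjg x) = norm x * norm x"
    unfolding norm_mult[symmetric] mult_conjg[of x] by (simp add: norm_mult power2_eq_square)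
  then show ?thesis
    using False by simp
qed simp

text \<open>Conjugation preserves the norm, so \<open>mult_conjg\<close> at x and at
  \<open>conjg x\<close> gives the same product; the nonzero factor \<open>conjg x\<close>
  cancels.\<close>

lemma conjg_conjg [simp]: "conjg (conjg x) = (x::'k::hilbert_scalar)"
proof (cases "x = 0")
  case False
  have "conjg x * conjg (conjg x) = conjg x * x"
    using mult_conjg[of "conjg x"] mult_conjg[of x] by (simp add: mult.commute)
  moreover have "conjg x \<noteq> 0"
    using False norm_conjg[of x] by force
  ultimately show ?thesis
    by simp
qed simp

text \<open>Lets conjugation pass through infinite sums, which the self-adjointness of
  \<open>T\<close> rests on.\<close>

lemma bounded_linear_conjg: "bounded_linear (conjg :: 'k::hilbert_scalar \<Rightarrow> 'k)"
  by (rule bounded_linear_intro[where K = 1])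
    (simp_all add: conjg_add conjg_mult scaleR_conv_of_real)

context separable_hilbert_space
begin

lemma ip_scaleR_left [simp]: "ip (r *\<^sub>R x) y = of_real r * ip x y"
  using ip_smul_left[of "of_real r" x y] by (simp add: smul_of_real)

lemma ip_scaleR_right [simp]: "ip x (r *\<^sub>R y) = of_real r * ip x y"
  using ip_commute[of x "r *\<^sub>R y"] ip_commute[of x y] by (simp add: conjg_mult)

lemma ip_add_right: "ip x (y + z) = ip x y + ip x z"
  using ip_commute[of x "y + z"] ip_commute[of x y] ip_commute[of x z]
  by (simp add: ip_add_left conjg_add)

lemma ip_smul_right: "ip x (smul a y) = conjg a * ip x y"
  using ip_commute[of x "smul a y"] ip_commute[of x y] by (simp add: ip_smul_left conjg_mult)

lemma ip_diff_left: "ip (x - y) z = ip x z - ip y z"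
  using ip_add_left[of "x - y" y z] by (simp add: algebra_simps)

lemma ip_diff_right: "ip x (y - z) = ip x y - ip x z"
  using ip_add_right[of x "y - z" z] by (simp add: algebra_simps)

lemma ip_zero_left [simp]: "ip 0 y = 0"
  using ip_diff_left[of 0 0 y] by simp

lemma ip_zero_right [simp]: "ip y 0 = 0"
  using ip_diff_right[of y 0 0] by simp

lemma ip_sum_left: "ip (\<Sum>i\<in>F. v i) y = (\<Sum>i\<in>F. ip (v i) y)"
  by (induction F rule: infinite_finite_induct) (simp_all add: ip_add_left)

lemma norm_ip_commute: "norm (ip x y) = norm (ip y x)"
  by (metis ip_commute norm_conjg)

lemma ip_mult_ip_commute: "ip x y * ip y x = of_real ((norm (ip x y))\<^sup>2)"
  by (metis ip_commute mult_conjg of_real_def)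

text \<open>Cauchy-Schwarz. The vector \<open>z\<close> is the component of x orthogonal to y,
  scaled by the squared norm of y to avoid division; expanding its squared norm gives the
  claim.\<close>

lemma norm_ip_le: "norm (ip x y) \<le> norm x * norm y"
proof (cases "y = 0")
  case False
  define z where "z = (norm y)\<^sup>2 *\<^sub>R x - smul (ip x y) y"
  have "of_real ((norm z)\<^sup>2) = ip z z"
    by (simp add: ip_self)
  also have "\<dots> = of_real ((norm y)\<^sup>2 * ((norm y)\<^sup>2 * (norm x)\<^sup>2))
      - of_real ((norm y)\<^sup>2) * (ip x y * conjg (ip x y))
      - (of_real ((norm y)\<^sup>2) * (ip x y * ip y x)
         - ip x y * conjg (ip x y) * of_real ((norm y)\<^sup>2))"
    unfolding z_def by (simp add: ip_diff_left ip_diff_right ip_smul_left ip_smul_right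
        ip_self[of x] ip_self[of y] algebra_simps)
  also have "\<dots> = of_real ((norm y)\<^sup>2 * ((norm y)\<^sup>2 * (norm x)\<^sup>2 - (norm (ip x y))\<^sup>2))"
    unfolding ip_commute[of y x, symmetric] ip_mult_ip_commute by (simp add: algebra_simps)
  finally have "(norm z)\<^sup>2 = (norm y)\<^sup>2 * ((norm y)\<^sup>2 * (norm x)\<^sup>2 - (norm (ip x y))\<^sup>2)"
    unfolding of_real_eq_iff .
  then have "0 \<le> (norm y)\<^sup>2 * ((norm y)\<^sup>2 * (norm x)\<^sup>2 - (norm (ip x y))\<^sup>2)"
    by (metis zero_le_power2)
  then have "(norm (ip x y))\<^sup>2 \<le> (norm x * norm y)\<^sup>2"
    using False by (simp add: zero_le_mult_iff power_mult_distrib mult.commute)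
  then show ?thesis
    by (rule power2_le_imp_le) simp
qed simp

lemma bounded_linear_ip_left: "bounded_linear (\<lambda>x. ip x y)"
  by (rule bounded_linear_intro[where K = "norm y"])
    (simp_all add: ip_add_left norm_ip_le scaleR_conv_of_real)

lemma norm_diff_scaleR_square:
  assumes "ip x y = of_real c"
  shows "(norm (x - t *\<^sub>R y))\<^sup>2 = (norm x)\<^sup>2 - 2 * t * c + t\<^sup>2 * (norm y)\<^sup>2"
proof -
  have "ip y x = of_real c"
    using assms ip_commute[of y x] by simp
  then have "of_real ((norm (x - t *\<^sub>R y))\<^sup>2) =
      (of_real ((norm x)\<^sup>2 - 2 * t * c + t\<^sup>2 * (norm y)\<^sup>2) :: 'k)"
    using assms ip_self[of x] ip_self[of y] ip_self[of "x - t *\<^sub>R y"]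
    by (simp add: ip_diff_left ip_diff_right algebra_simps power2_eq_square)
  then show ?thesis
    unfolding of_real_eq_iff .
qed

end

section \<open>Bessel families\<close>

text \<open>Cauchy criterion for nets of finite sums: the hypothesis bounds every block of
  \<open>f\<close> by a block of \<open>g\<close>, and blocks of \<open>g\<close> outside a large
  finite set are small.\<close>

lemma summable_on_of_norm_square_sum_le:
  fixes f :: "'i \<Rightarrow> 'v::banach" and g :: "'i \<Rightarrow> real"
  assumes g: "g summable_on A"
    and le: "\<And>F. finite F \<Longrightarrow> F \<subseteq> A \<Longrightarrow> (norm (sum f F))\<^sup>2 \<le> sum g F"
  shows "f summable_on A"
proof -
  have g_nonneg: "0 \<le> g i" if "i \<in> A" for i
    using le[of "{i}"] that by (simp add: order_trans[OF zero_le_power2])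
  have "\<exists>P. eventually P (finite_subsets_at_top A) \<and>
      (\<forall>F F'. P F \<and> P F' \<longrightarrow> dist (sum f F) (sum f F') < e)" if "e > 0" for e
  proof -
    have "(sum g \<longlongrightarrow> infsum g A) (finite_subsets_at_top A)"
      using has_sum_infsum[OF g] by (simp add: has_sum_def)
    then have "\<forall>\<^sub>F F in finite_subsets_at_top A. dist (sum g F) (infsum g A) < (e/2)\<^sup>2"
      using that by (intro tendstoD) auto
    then obtain F0 where F0: "finite F0" "F0 \<subseteq> A" "dist (sum g F0) (infsum g A) < (e/2)\<^sup>2"
      unfolding eventually_finite_subsets_at_top by blast
    \<comment> \<open>Both sums are compared with the one over \<open>F0\<close>: by inclusion the
      difference is a single block over \<open>F - F0\<close>, to which \<open>le\<close>
      applies.\<close>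
    have near: "dist (sum f F) (sum f F0) < e/2" if "finite F" "F0 \<subseteq> F" "F \<subseteq> A" for F
    proof -
      have "(dist (sum f F) (sum f F0))\<^sup>2 = (norm (sum f (F - F0)))\<^sup>2"
        using that F0 by (simp add: dist_norm sum_diff)
      also have "\<dots> \<le> sum g (F - F0)"
        using that by (intro le) auto
      also have "\<dots> = sum g F - sum g F0"
        using that F0 by (simp add: sum_diff)
      also have "\<dots> \<le> infsum g A - sum g F0"
        using finite_sum_le_infsum[OF g, of F] that g_nonneg by simp
      also have "\<dots> < (e/2)\<^sup>2"
        using F0(3) by (simp add: dist_real_def)
      finally show ?thesis
        by (rule power2_less_imp_less) (use \<open>e > 0\<close> in simp)
    qed
    have "eventually (\<lambda>F. finite F \<and> F0 \<subseteq> F \<and> F \<subseteq> A) (finite_subsets_at_top A)"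
      unfolding eventually_finite_subsets_at_top using F0 by blast
    moreover have "dist (sum f F) (sum f F') < e"
      if "finite F \<and> F0 \<subseteq> F \<and> F \<subseteq> A" "finite F' \<and> F0 \<subseteq> F' \<and> F' \<subseteq> A" for F F'
      using dist_triangle_half_l[of "sum f F" "sum f F0" e "sum f F'"] near that by simp
    ultimately show ?thesis
      by (intro exI[of _ "\<lambda>F. finite F \<and> F0 \<subseteq> F \<and> F \<subseteq> A"] conjI) simp_all
  qed
  then have "cauchy_filter (filtermap (sum f) (finite_subsets_at_top A))"
    by (simp add: cauchy_filter_metric_filtermap)
  then obtain L where "(sum f \<longlongrightarrow> L) (finite_subsets_at_top A)"
    using complete_UNIV complete_uniform[where S = "UNIV::'v set"] by (force simp: filterlim_def)
  then show ?thesis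
    using summable_on_def has_sum_def by blast
qed

text \<open>Only the upper frame bound is required, so that the weaving and both of its halves are
  instances with the same \<open>B\<close>.\<close>

locale bessel_family = separable_hilbert_space smul ip
  for smul :: "'k::hilbert_scalar \<Rightarrow> 'v::banach \<Rightarrow> 'v" and ip +
  fixes J :: "'i set" and w :: "'i \<Rightarrow> 'v" and B :: real
  assumes bound_pos: "B > 0"
    and summable: "(\<lambda>i. (norm (ip h (w i)))\<^sup>2) summable_on J"
    and bessel: "(\<Sum>\<^sub>\<infinity>i\<in>J. (norm (ip h (w i)))\<^sup>2) \<le> B * (norm h)\<^sup>2"
begin

definition T :: "'v \<Rightarrow> 'v" where "T = partial_frame_operator smul ip J w"

definition q :: "'v \<Rightarrow> real" where "q h = (\<Sum>\<^sub>\<infinity>i\<in>J. (norm (ip h (w i)))\<^sup>2)"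

lemma q_nonneg: "0 \<le> q h"
  unfolding q_def by (intro infsum_nonneg) simp

lemma q_le: "q h \<le> B * (norm h)\<^sup>2"
  unfolding q_def by (rule bessel)

text \<open>Boundedness of the synthesis map on finite sums. Expand \<langle>v, v\<rangle> and apply
  Young's inequality with weight \<open>B\<close>; the Bessel bound turns the second half into half
  the squared norm of \<open>v\<close>, which the left side absorbs.\<close>

lemma norm_sum_smul_square_le:
  assumes F: "finite F" "F \<subseteq> J"
  shows "(norm (\<Sum>i\<in>F. smul (c i) (w i)))\<^sup>2 \<le> (\<Sum>i\<in>F. B * (norm (c i))\<^sup>2)"
proof -
  define v where "v = (\<Sum>i\<in>F. smul (c i) (w i))"
  have "(norm v)\<^sup>2 = norm (ip v v)"
    by (simp add: ip_self norm_power)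
  also have "ip v v = (\<Sum>i\<in>F. c i * ip (w i) v)"
    by (subst (1) v_def) (simp add: ip_sum_left ip_smul_left)
  also have "norm \<dots> \<le> (\<Sum>i\<in>F. norm (c i) * norm (ip v (w i)))"
    by (rule sum_norm_le) (simp add: norm_mult norm_ip_commute)
  also have "\<dots> \<le> (\<Sum>i\<in>F. (B * (norm (c i))\<^sup>2 + (norm (ip v (w i)))\<^sup>2 / B) / 2)"
  proof (rule sum_mono)
    fix i
    have "0 \<le> (B * norm (c i) - norm (ip v (w i)))\<^sup>2 / B"
      using bound_pos by simp
    then show "norm (c i) * norm (ip v (w i)) \<le> (B * (norm (c i))\<^sup>2 + (norm (ip v (w i)))\<^sup>2 / B) / 2"
      using bound_pos by (simp add: power2_eq_square field_simps)
  qed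
  also have "\<dots> = (\<Sum>i\<in>F. B * (norm (c i))\<^sup>2) / 2 + (\<Sum>i\<in>F. (norm (ip v (w i)))\<^sup>2) / B / 2"
    by (simp add: sum.distrib sum_divide_distrib[symmetric] add_divide_distrib)
  also have "\<dots> \<le> (\<Sum>i\<in>F. B * (norm (c i))\<^sup>2) / 2 + (norm v)\<^sup>2 / 2"
  proof -
    have "(\<Sum>i\<in>F. (norm (ip v (w i)))\<^sup>2) \<le> B * (norm v)\<^sup>2"
      using finite_sum_le_infsum[OF summable F] bessel[of v] by (meson order_trans zero_le_power2)
    then show ?thesis
      using bound_pos by (simp add: divide_le_eq mult.commute)
  qed
  finally show ?thesis
    unfolding v_def by simp
qed

lemma T_has_sum: "((\<lambda>i. smul (ip h (w i)) (w i)) has_sum T h) J"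
proof -
  have "(\<lambda>i. smul (ip h (w i)) (w i)) summable_on J"
    using summable_on_cmult_right[OF summable] norm_sum_smul_square_le
    by (rule summable_on_of_norm_square_sum_le)
  then show ?thesis
    unfolding T_def partial_frame_operator_def by (rule has_sum_infsum)
qed

lemma ip_T_has_sum: "((\<lambda>i. ip x (w i) * ip (w i) y) has_sum ip (T x) y) J"
  using has_sum_bounded_linear[OF bounded_linear_ip_left T_has_sum] by (simp add: ip_smul_left)

lemma ip_T_self: "ip (T x) x = of_real (q x)"
proof -
  have "((\<lambda>i. of_real ((norm (ip x (w i)))\<^sup>2)) has_sum (of_real (q x) :: 'k)) J"
    unfolding q_def by (intro has_sum_of_real has_sum_infsum summable)
  with ip_T_has_sum[of x x] show ?thesis
    unfolding ip_mult_ip_commute by (rule has_sum_unique)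
qed

text \<open>Self-adjointness: conjugating the series of \<open>ip (T y) x\<close> term by term gives
  the series of \<open>ip (T x) y\<close>.\<close>

lemma ip_T_commute: "ip (T x) y = ip x (T y)"
proof -
  have "((\<lambda>i. conjg (ip y (w i) * ip (w i) x)) has_sum conjg (ip (T y) x)) J"
    by (rule has_sum_bounded_linear[OF bounded_linear_conjg ip_T_has_sum])
  then have "((\<lambda>i. ip x (w i) * ip (w i) y) has_sum ip x (T y)) J"
    by (simp add: conjg_mult ip_commute[symmetric] mult.commute)
  with ip_T_has_sum show ?thesis
    by (rule has_sum_unique)
qed

lemma T_diff: "T (x - y) = T x - T y"
proof -
  have "((\<lambda>i. smul (ip x (w i)) (w i)) has_sum (T (x - y) + T y)) J"
    using has_sum_add[OF T_has_sum[of "x - y"] T_has_sum[of y]]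
    by (simp add: scale_left_distrib[symmetric] ip_add_left[symmetric])
  then have "T (x - y) + T y = T x"
    using T_has_sum by (rule has_sum_unique)
  then show ?thesis
    by (simp add: algebra_simps)
qed

lemma T_scaleR: "T (r *\<^sub>R x) = r *\<^sub>R T x"
proof -
  have "((\<lambda>i. r *\<^sub>R smul (ip x (w i)) (w i)) has_sum r *\<^sub>R T x) J"
    by (intro has_sum_scaleR T_has_sum)
  with T_has_sum[of "r *\<^sub>R x"] show ?thesis
    unfolding ip_scaleR_left scale_scale[symmetric] smul_of_real by (rule has_sum_unique)
qed

text \<open>Since \<open>T\<close> is self-adjoint and the mixed term is real, the two cross terms
  coincide. Both bounds of the theorem are instances.\<close>

lemma q_diff_scaleR:
  assumes "ip (T x) y = of_real c"
  shows "q (x - t *\<^sub>R y) = q x - 2 * t * c + t\<^sup>2 * q y"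
proof -
  have "ip (T y) x = of_real c"
    using assms ip_T_commute[of y x] ip_commute[of y "T x"] by (metis conjg_of_real)
  then have "of_real (q (x - t *\<^sub>R y)) = (of_real (q x - 2 * t * c + t\<^sup>2 * q y) :: 'k)"
    unfolding ip_T_self[symmetric] of_real_diff of_real_add of_real_mult
    using assms
    by (simp add: T_diff T_scaleR ip_diff_left ip_diff_right algebra_simps power2_eq_square)
  then show ?thesis
    unfolding of_real_eq_iff .
qed

text \<open>Nonnegativity of \<open>q\<close> at \<open>x - (1/B) *\<^sub>R T x\<close>. The bound
  is linear in \<open>q x\<close>, so in \<open>surj_T\<close> it can be offset against the cross
  term.\<close>

lemma norm_T_square_le: "(norm (T x))\<^sup>2 \<le> B * q x"
proof -
  have "q (x - (1/B) *\<^sub>R T x) = q x - 2 * (1/B) * (norm (T x))\<^sup>2 + (1/B)\<^sup>2 * q (T x)"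
    by (rule q_diff_scaleR) (rule ip_self)
  moreover have "(1/B)\<^sup>2 * q (T x) \<le> (1/B)\<^sup>2 * (B * (norm (T x))\<^sup>2)"
    by (intro mult_left_mono q_le) simp
  ultimately have "(norm (T x))\<^sup>2 / B \<le> q x"
    using bound_pos q_nonneg[of "x - (1/B) *\<^sub>R T x"] by (simp add: power2_eq_square)
  then show ?thesis
    using bound_pos by (simp add: field_simps)
qed

lemma surj_T:
  assumes "A > 0" and lower: "\<And>h. A * (norm h)\<^sup>2 \<le> q h"
  shows "surj T"
proof -
  \<comment> \<open>The estimate below gives the squared factor 1 - A/B; the maximum with 0 covers
    the zero space, where A may exceed B.\<close>
  define c where "c = sqrt (max 0 (1 - A / B))"
  have c: "0 \<le> c" "c < 1"
    unfolding c_def using \<open>A > 0\<close> bound_pos by (simp_all add: real_sqrt_lt_1_iff)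
  have contr: "norm (h - (1/B) *\<^sub>R T h) \<le> c * norm h" for h
  proof -
    have "ip h (T h) = of_real (q h)"
      by (simp add: ip_T_self flip: ip_T_commute)
    then have "(norm (h - (1/B) *\<^sub>R T h))\<^sup>2 = (norm h)\<^sup>2 - 2 * (1/B) * q h + (1/B)\<^sup>2 * (norm (T h))\<^sup>2"
      by (rule norm_diff_scaleR_square)
    also have "\<dots> \<le> (norm h)\<^sup>2 - 2 * (1/B) * q h + (1/B)\<^sup>2 * (B * q h)"
      by (intro add_left_mono mult_left_mono norm_T_square_le) simp
    also have "\<dots> = (norm h)\<^sup>2 - q h / B"
      using bound_pos by (simp add: power2_eq_square)
    also have "\<dots> \<le> (norm h)\<^sup>2 - A * (norm h)\<^sup>2 / B"
      using divide_right_mono[OF lower, of B h] bound_pos by simp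
    also have "\<dots> = (1 - A / B) * (norm h)\<^sup>2"
      by (simp add: algebra_simps)
    also have "\<dots> \<le> (c * norm h)\<^sup>2"
      unfolding c_def by (simp add: power_mult_distrib mult_right_mono)
    finally show ?thesis
      by (rule power2_le_imp_le) (use c in simp)
  qed
  have "\<exists>x. y = T x" for y
  proof -
    have "\<exists>!x. x - (1/B) *\<^sub>R (T x - y) = x"
    proof (rule banach_fix_type[OF c], intro allI)
      fix x x'
      have "(x - (1/B) *\<^sub>R (T x - y)) - (x' - (1/B) *\<^sub>R (T x' - y))
          = (x - x') - (1/B) *\<^sub>R T (x - x')"
        by (simp add: T_diff algebra_simps)
      then show "dist (x - (1/B) *\<^sub>R (T x - y)) (x' - (1/B) *\<^sub>R (T x' - y)) \<le> c * dist x x'"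
        unfolding dist_norm by (simp only: contr)
    qed
    then obtain x where "x - (1/B) *\<^sub>R (T x - y) = x"
      by blast
    then show ?thesis
      using bound_pos by auto
  qed
  then show ?thesis
    by (simp add: surj_def)
qed

text \<open>Dropping nonnegative terms keeps the bound. Agreement is asked on \<open>K\<close> only,
  since the weaving follows each of the two frames on just one part of the index set.\<close>

lemma bessel_family_subset:
  assumes "K \<subseteq> J" and "\<And>i. i \<in> K \<Longrightarrow> v i = w i"
  shows "bessel_family smul ip K v B"
proof unfold_locales
  fix h
  have sub: "(\<lambda>i. (norm (ip h (w i)))\<^sup>2) summable_on K"
    using summable assms(1) by (rule summable_on_subset_banach)
  then show "(\<lambda>i. (norm (ip h (v i)))\<^sup>2) summable_on K"
    using assms(2) by (simp cong: summable_on_cong)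
  have "(\<Sum>\<^sub>\<infinity>i\<in>K. (norm (ip h (v i)))\<^sup>2) = (\<Sum>\<^sub>\<infinity>i\<in>K. (norm (ip h (w i)))\<^sup>2)"
    using assms(2) by (simp cong: infsum_cong)
  also have "\<dots> \<le> (\<Sum>\<^sub>\<infinity>i\<in>J. (norm (ip h (w i)))\<^sup>2)"
    using sub summable assms(1) by (rule infsum_mono2) simp
  finally show "(\<Sum>\<^sub>\<infinity>i\<in>K. (norm (ip h (v i)))\<^sup>2) \<le> B * (norm h)\<^sup>2"
    using bessel[of h] by simp
qed (rule bound_pos)

end

theorem theorem14:
  fixes smul :: "'k::hilbert_scalar \<Rightarrow> 'v::banach \<Rightarrow> 'v"
    and ip :: "'v \<Rightarrow> 'v \<Rightarrow> 'k"
    and I \<sigma> :: "'i set"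
    and \<phi> \<psi> :: "'i \<Rightarrow> 'v"
    and lam :: real
    and f :: 'v
  assumes "separable_hilbert_space smul ip"
    and "countable I"
    and "woven_frames ip I \<phi> \<psi>"
    and "\<sigma> \<subseteq> I"
  defines "S\<sigma> \<equiv> partial_frame_operator smul ip \<sigma> \<phi>"
    and "Sinv \<equiv> inv (weaving_frame_operator smul ip I \<phi> \<psi> \<sigma>)"
  shows "0 \<le> (\<Sum>\<^sub>\<infinity>i\<in>\<sigma>. (norm (ip f (\<phi> i)))\<^sup>2)
             - (\<Sum>\<^sub>\<infinity>i\<in>\<sigma>. (norm (ip (S\<sigma> f) (Sinv (\<phi> i))))\<^sup>2)
             - (\<Sum>\<^sub>\<infinity>i\<in>I - \<sigma>. (norm (ip (S\<sigma> f) (Sinv (\<psi> i))))\<^sup>2)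
       \<and> (\<Sum>\<^sub>\<infinity>i\<in>\<sigma>. (norm (ip f (\<phi> i)))\<^sup>2)
             - (\<Sum>\<^sub>\<infinity>i\<in>\<sigma>. (norm (ip (S\<sigma> f) (Sinv (\<phi> i))))\<^sup>2)
             - (\<Sum>\<^sub>\<infinity>i\<in>I - \<sigma>. (norm (ip (S\<sigma> f) (Sinv (\<psi> i))))\<^sup>2)
           \<le> lam\<^sup>2 / 4 * (\<Sum>\<^sub>\<infinity>i\<in>I - \<sigma>. (norm (ip f (\<psi> i)))\<^sup>2)
             + (1 - lam / 2)\<^sup>2 * (\<Sum>\<^sub>\<infinity>i\<in>\<sigma>. (norm (ip f (\<phi> i)))\<^sup>2)"
proof -
  interpret separable_hilbert_space smul ip
    by fact
  define w where "w = weaving \<sigma> \<phi> \<psi>"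
  obtain A B where "frame_with_bounds ip I A B w"
    using assms(3,4) unfolding woven_frames_def w_def by blast
  then have A: "A > 0" and "B > 0"
    and frame: "(\<lambda>i. (norm (ip h (w i)))\<^sup>2) summable_on I"
      "A * (norm h)\<^sup>2 \<le> (\<Sum>\<^sub>\<infinity>i\<in>I. (norm (ip h (w i)))\<^sup>2)"
      "(\<Sum>\<^sub>\<infinity>i\<in>I. (norm (ip h (w i)))\<^sup>2) \<le> B * (norm h)\<^sup>2" for h
    unfolding frame_with_bounds_def by blast+
  have w: "\<phi> i = w i" if "i \<in> \<sigma>" for i
    using that by (simp add: w_def weaving_def)
  have w': "\<psi> i = w i" if "i \<in> I - \<sigma>" for i
    using that by (simp add: w_def weaving_def)
  interpret W: bessel_family smul ip I w B
    by unfold_locales (use \<open>B > 0\<close> frame in auto)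
  interpret P: bessel_family smul ip \<sigma> \<phi> B
    using \<open>\<sigma> \<subseteq> I\<close> w by (rule W.bessel_family_subset)
  interpret Q: bessel_family smul ip "I - \<sigma>" \<psi> B
    using Diff_subset w' by (rule W.bessel_family_subset)
  have I: "\<sigma> \<union> (I - \<sigma>) = I" and disj: "\<sigma> \<inter> (I - \<sigma>) = {}"
    using \<open>\<sigma> \<subseteq> I\<close> by auto
  have T_split: "W.T h = P.T h + Q.T h" for h
  proof (rule has_sum_unique[OF W.T_has_sum])
    have "((\<lambda>i. smul (ip h (w i)) (w i)) has_sum P.T h) \<sigma>"
      by (rule has_sum_cong[THEN iffD1, OF _ P.T_has_sum]) (simp add: w)
    moreover have "((\<lambda>i. smul (ip h (w i)) (w i)) has_sum Q.T h) (I - \<sigma>)"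
      by (rule has_sum_cong[THEN iffD1, OF _ Q.T_has_sum]) (simp add: w')
    ultimately show "((\<lambda>i. smul (ip h (w i)) (w i)) has_sum P.T h + Q.T h) I"
      using has_sum_Un_disjoint[OF _ _ disj] I by metis
  qed
  \<comment> \<open>Read off from the operators through \<langle>T h, h\<rangle> = q(h), so that no
    sum has to be split again.\<close>
  have q_split: "W.q h = P.q h + Q.q h" for h
  proof -
    have "of_real (W.q h) = (of_real (P.q h + Q.q h) :: 'k)"
      by (simp add: W.ip_T_self[symmetric] P.ip_T_self[symmetric] Q.ip_T_self[symmetric]
          T_split ip_add_left)
    then show ?thesis
      unfolding of_real_eq_iff .
  qed
  have "surj W.T"
    using A frame(2) by (intro W.surj_T[of A]) (auto simp: W.q_def)
  moreover have Sinv: "Sinv = inv W.T"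
    unfolding Sinv_def by (rule arg_cong[of _ _ inv])
      (simp add: fun_eq_iff T_split weaving_frame_operator_def P.T_def Q.T_def)
  ultimately have T_Sinv: "W.T (Sinv y) = y" for y
    by (simp add: surj_f_inv_f)
  define g where "g = Sinv (P.T f)"
  have Tg: "W.T g = P.T f"
    by (simp add: g_def T_Sinv)
  \<comment> \<open>With S the weaving operator: \<langle>S g, Sinv y\<rangle> = \<langle>g, S (Sinv
    y)\<rangle> = \<langle>g, y\<rangle>.\<close>
  have "ip (S\<sigma> f) (Sinv y) = ip g y" for y
    by (metis S\<sigma>_def P.T_def Tg W.ip_T_commute T_Sinv)
  then have middle: "(\<Sum>\<^sub>\<infinity>i\<in>\<sigma>. (norm (ip f (\<phi> i)))\<^sup>2)
             - (\<Sum>\<^sub>\<infinity>i\<in>\<sigma>. (norm (ip (S\<sigma> f) (Sinv (\<phi> i))))\<^sup>2)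
             - (\<Sum>\<^sub>\<infinity>i\<in>I - \<sigma>. (norm (ip (S\<sigma> f) (Sinv (\<psi> i))))\<^sup>2) = P.q f - W.q g"
    by (simp add: P.q_def Q.q_def q_split)
  have "ip (P.T f) g = of_real (W.q g)"
    by (simp add: Tg[symmetric] W.ip_T_self)
  \<comment> \<open>Here 0 \<le> P.q(f - g) = P.q(f) - 2 W.q(g) + P.q(g), and P.q(g) \<le>
    W.q(g).\<close>
  from P.q_diff_scaleR[OF this, of 1] have lower: "W.q g \<le> P.q f"
    using P.q_nonneg[of "f - 1 *\<^sub>R g"] Q.q_nonneg[of g] q_split[of g] by simp
  have "ip (W.T g) f = of_real (P.q f)"
    by (simp add: Tg P.ip_T_self)
  from W.q_diff_scaleR[OF this, of "lam / 2"]
  have "0 \<le> W.q g - lam * P.q f + lam\<^sup>2 / 4 * (P.q f + Q.q f)"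
    using W.q_nonneg[of "g - (lam / 2) *\<^sub>R f"] by (simp add: q_split power_divide)
  \<comment> \<open>The coefficient of \<open>P.q f\<close> becomes 1 - lam + lam^2/4, a perfect
    square.\<close>
  then have "P.q f - W.q g \<le> lam\<^sup>2 / 4 * Q.q f + (1 - lam / 2)\<^sup>2 * P.q f"
    by (simp add: power2_eq_square algebra_simps)
  with lower show ?thesis
    unfolding middle unfolding P.q_def[of f, symmetric] Q.q_def[of f, symmetric] by simp
qed

end
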